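(* Let $N$ be a matroid whose ground set $E(N)$ has exactly $12$ elements and which has a circuit-cocircuit intersection of size $7$ (that is, $N$ is a CCI-envelope of a CCI of size $k=7$, where $2k-2=12$). Then $N$ has a circuit-cocircuit intersection of size $5$.
   Context: A circuit-cocircuit intersection (CCI) of a matroid $M$ is a subset of $E(M)$ of the form $C\cap C^{\ast}$ with $C$ a circuit of $M$ and $C^{\ast}$ a cocircuit of $M$ (a circuit of the dual matroid $M^{\ast}$). For an integer $k\ge 4$, a CCI-envelope (of a CCI of size $k$) is a matroid that contains a CCI of size $k$ and whose ground set has size $2k-2$. The CCI conjecture (for $k$) is the statement that every CCI-envelope of a CCI of size $k$ has a CCI of size $k-2$. *)

theory Defs
  imports Main
begin

locale matroid =
  fixes E :: "'a set" and indep :: "'a set \<Rightarrow> bool"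
  assumes finite_ground: "finite E"
    and indep_ground: "indep X \<Longrightarrow> X \<subseteq> E"
    and indep_empty: "indep {}"
    and indep_subset: "indep X \<Longrightarrow> Y \<subseteq> X \<Longrightarrow> indep Y"
    and augment: "indep X \<Longrightarrow> indep Y \<Longrightarrow> card X < card Y \<Longrightarrow> \<exists>y\<in>Y - X. indep (insert y X)"

definition basis :: "('a set \<Rightarrow> bool) \<Rightarrow> 'a set \<Rightarrow> bool" where
  "basis indep B \<longleftrightarrow> indep B \<and> (\<forall>X. indep X \<longrightarrow> B \<subseteq> X \<longrightarrow> X = B)"

definition circuit :: "'a set \<Rightarrow> ('a set \<Rightarrow> bool) \<Rightarrow> 'a set \<Rightarrow> bool" where
  "circuit E indep C \<longleftrightarrow> C \<subseteq> E \<and> \<not> indep C \<and> (\<forall>D. D \<subset> C \<longrightarrow> indep D)"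

(* The bases of the dual are the complements of the bases, so its independent sets are
   the subsets of E that avoid some basis. *)
definition dual_indep :: "'a set \<Rightarrow> ('a set \<Rightarrow> bool) \<Rightarrow> 'a set \<Rightarrow> bool" where
  "dual_indep E indep X \<longleftrightarrow> (\<exists>B. basis indep B \<and> X \<subseteq> E - B)"

definition cocircuit :: "'a set \<Rightarrow> ('a set \<Rightarrow> bool) \<Rightarrow> 'a set \<Rightarrow> bool" where
  "cocircuit E indep C \<longleftrightarrow> circuit E (dual_indep E indep) C"

definition cci :: "'a set \<Rightarrow> ('a set \<Rightarrow> bool) \<Rightarrow> 'a set \<Rightarrow> bool" where
  "cci E indep X \<longleftrightarrow> (\<exists>C D. circuit E indep C \<and> cocircuit E indep D \<and> X = C \<inter> D)"

context matroid
begin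

lemma finite_indep: "indep X \<Longrightarrow> finite X"
  by (rule finite_subset[OF indep_ground finite_ground])

lemma card_le_basis:
  assumes "indep X" "basis indep B" shows "card X \<le> card B"
proof (rule ccontr)
  assume "\<not> card X \<le> card B"
  then obtain y where "y \<in> X - B" "indep (insert y B)"
    using augment[of B X] assms unfolding basis_def by auto
  then show False
    using assms(2) unfolding basis_def by blast
qed

lemma basis_if_card:
  assumes "indep X" "basis indep B" "card B \<le> card X" shows "basis indep X"
  unfolding basis_def
proof (intro conjI allI impI)
  fix Y assume "indep Y" "X \<subseteq> Y"
  then have "card Y \<le> card X"
    using card_le_basis[OF _ assms(2)] assms(3) by (meson le_trans)
  then show "Y = X"
    using card_seteq[of Y X] finite_indep[OF \<open>indep Y\<close>] \<open>X \<subseteq> Y\<close> by simp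
qed (fact assms(1))

lemma extend_to_basis:
  assumes "indep A" "basis indep B"
  obtains B' where "basis indep B'" "A \<subseteq> B'" "B' \<subseteq> A \<union> B"
proof -
  have "\<exists>B'. basis indep B' \<and> A \<subseteq> B' \<and> B' \<subseteq> A \<union> B"
    using assms(1)
  proof (induction "card B - card A" arbitrary: A rule: less_induct)
    case less
    show ?case
    proof (cases "card B \<le> card A")
      case True
      then show ?thesis using basis_if_card less.prems assms(2) by blast
    next
      case False
      then obtain y where y: "y \<in> B - A" "indep (insert y A)"
        using augment[OF less.prems, of B] assms(2) unfolding basis_def by auto
      have "card (insert y A) = Suc (card A)"
        using y finite_indep[OF less.prems] by simp
      then have "card B - card (insert y A) < card B - card A"
        using False by linarith
      from less.hyps[OF this y(2)] show ?thesis
        using y(1) by blast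
    qed
  qed
  then show ?thesis using that by blast
qed

lemma basis_exists: "\<exists>B. basis indep B"
proof -
  have "{X. indep X} \<subseteq> Pow E"
    using indep_ground by auto
  then have "finite {X. indep X}"
    using finite_ground finite_Pow_iff rev_finite_subset by metis
  then obtain B where "indep B" "\<And>X. indep X \<Longrightarrow> B \<subseteq> X \<Longrightarrow> B = X"
    using finite_has_maximal[of "{X. indep X}"] indep_empty by (metis empty_Collect_eq mem_Collect_eq)
  then have "basis indep B"
    unfolding basis_def by metis
  then show ?thesis ..
qed

lemma matroid_dual: "matroid E (dual_indep E indep)"
proof
  show "finite E" by (fact finite_ground)
  show "\<And>X. dual_indep E indep X \<Longrightarrow> X \<subseteq> E"
    unfolding dual_indep_def by blast
  show "dual_indep E indep {}"
    using basis_exists unfolding dual_indep_def by blast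
  show "\<And>X Y. dual_indep E indep X \<Longrightarrow> Y \<subseteq> X \<Longrightarrow> dual_indep E indep Y"
    unfolding dual_indep_def by blast
next
  fix X Y
  assume "dual_indep E indep X" "dual_indep E indep Y" and less: "card X < card Y"
  then obtain B1 B2 where B1: "basis indep B1" "X \<subseteq> E - B1" and B2: "basis indep B2" "Y \<subseteq> E - B2"
    unfolding dual_indep_def by blast
  have "finite X" "finite Y"
    using B1(2) B2(2) finite_ground by (auto intro: finite_subset)
  moreover have "finite B2"
    using B2(1) finite_indep unfolding basis_def by simp
  ultimately have fin: "finite X" "finite Y" "finite B2" by simp_all
  have "indep (B2 - X)"
    using B2(1) indep_subset[of B2] unfolding basis_def by simp
  then obtain B where B: "basis indep B" "B2 - X \<subseteq> B" "B \<subseteq> (B2 - X) \<union> B1"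
    using extend_to_basis[OF _ B1(1)] by metis
  have finB: "finite B"
    using B(1) finite_indep unfolding basis_def by simp
  have "\<not> Y - X \<subseteq> B"
  proof
    assume sub: "Y - X \<subseteq> B"
    have "card (Y - X) + card (B2 - X) = card ((Y - X) \<union> (B2 - X))"
      using fin B2(2) by (subst card_Un_disjoint) auto
    also have "\<dots> \<le> card B"
      using sub B(2) finB by (intro card_mono) auto
    also have "\<dots> \<le> card B2"
      using card_le_basis[OF _ B2(1)] B(1) unfolding basis_def by simp
    also have "\<dots> \<le> card ((B2 - X) \<union> (X - Y))"
      using fin B2(2) by (intro card_mono) auto
    also have "\<dots> \<le> card (B2 - X) + card (X - Y)"
      by (rule card_Un_le)
    finally have "card (Y - X) \<le> card (X - Y)" by simp
    with card_less_sym_Diff[OF fin(1,2) less] show False by simp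
  qed
  then obtain y where "y \<in> Y - X" "y \<notin> B" by blast
  then show "\<exists>y\<in>Y - X. dual_indep E indep (insert y X)"
    using B B1(2) B2(2) unfolding dual_indep_def by (intro bexI[of _ y] exI[of _ B]) auto
qed

end

end

theory Submission
  imports Defs
begin

text \<open>
  The bounds on the rank and corank force the circuit and the cocircuit of the given CCI to be the
  same 7-set X, and its complement Y is an independent hyperplane. Suppose that there is no CCI of
  size 5. For y in Y, the hyperplanes that contain Y - {y} partition X into blocks. Intersecting X
  with their complements excludes blocks of size 2, and spanning excludes blocks of size 6, so a
  partition without singletons has type 4+3 and one with a single singleton has type 3+3+1.
  The rank-3 contractions by Y - {y,z} restrict how the partitions for y and z interact; a rank
  count in ranks 4 and 5 excludes four partitions of type 4+3. The situation is self-dual, and an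
  intersection of a circuit X + y - a, where {a} is a block of the dual partition, with a cocircuit
  X + z - b, where {b} is a block, has size 5 unless y = z or a = b. Hence two singletons in one
  partition would make the dual partitions for the other four elements all of type 4+3. So every
  partition has type 4+3 or 3+3+1, at least two on each side have type 3+3+1, and comparing
  the singletons gives a contradiction.
\<close>

section \<open>Closure, cocircuits and duality\<close>

context matroid
begin

text \<open>For independent \<open>I\<close> this is the usual matroid closure; for dependent
  \<open>I\<close> the formula gives all of \<open>E\<close>.\<close>

definition closure :: "'a set \<Rightarrow> 'a set" where
  "closure I = {e \<in> E. e \<in> I \<or> \<not> indep (insert e I)}"

lemma subset_closure: "indep I \<Longrightarrow> I \<subseteq> closure I"
  using indep_ground unfolding closure_def by blast

lemma not_in_closure: "e \<in> E \<Longrightarrow> e \<notin> closure I \<Longrightarrow> e \<notin> I \<and> indep (insert e I)"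
  unfolding closure_def by blast

lemma card_le_closure:
  assumes "indep I" "indep J" "J \<subseteq> closure I"
  shows "card J \<le> card I"
  using augment[OF assms(1,2)] assms(3) unfolding closure_def by fastforce

lemma extend_indep:
  assumes "indep I" "indep K"
  obtains J where "indep J" "I \<subseteq> J" "J \<subseteq> I \<union> K" "card K \<le> card J"
proof -
  have "\<exists>J. indep J \<and> I \<subseteq> J \<and> J \<subseteq> I \<union> K \<and> card K \<le> card J"
    using assms(1)
  proof (induction "card K - card I" arbitrary: I rule: less_induct)
    case less
    show ?case
    proof (cases "card K \<le> card I")
      case False
      then obtain y where y: "y \<in> K - I" "indep (insert y I)"
        using augment[OF less.prems assms(2)] by auto
      then have "card K - card (insert y I) < card K - card I"
        using False finite_indep[OF less.prems] by simp
      from less.hyps[OF this y(2)] show ?thesis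
        using y(1) by blast
    qed (use less.prems in blast)
  qed
  then show ?thesis using that by blast
qed

text \<open>If some \<open>e\<close> in \<open>closure I\<close> were independent of
  \<open>J\<close>, extending \<open>I\<close> by elements of \<open>insert e J\<close> could not
  use \<open>e\<close>, so it would put \<open>card J + 1\<close> independent elements into
  \<open>closure J\<close>.\<close>

lemma closure_mono:
  assumes "indep I" "indep J" "I \<subseteq> closure J"
  shows "closure I \<subseteq> closure J"
proof
  fix e assume e: "e \<in> closure I"
  show "e \<in> closure J"
  proof (rule ccontr)
    assume n: "e \<notin> closure J"
    then have J: "e \<notin> J" "indep (insert e J)" and "e \<notin> I"
      using e assms(3) unfolding closure_def by auto
    obtain K where K: "indep K" "I \<subseteq> K" "K \<subseteq> I \<union> insert e J" "card (insert e J) \<le> card K"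
      using extend_indep[OF assms(1) J(2)] .
    have "e \<notin> K"
      using e \<open>e \<notin> I\<close> indep_subset[OF K(1), of "insert e I"] K(2) unfolding closure_def by auto
    then have "K \<subseteq> closure J"
      using K(3) assms(3) subset_closure[OF assms(2)] by blast
    then have "card K \<le> card J"
      by (rule card_le_closure[OF assms(2) K(1)])
    then show False
      using K(4) J(1) finite_indep[OF assms(2)] by simp
  qed
qed

text \<open>A point of \<open>I\<close> outside \<open>closure J\<close> would extend
  \<open>J\<close> to an independent subset of \<open>closure I\<close> that is larger than
  \<open>I\<close>.\<close>

lemma closure_eq:
  assumes "indep I" "indep J" "J \<subseteq> closure I" "card J = card I"
  shows "closure J = closure I"
proof
  show "closure J \<subseteq> closure I"
    using closure_mono assms by blast
  have "I \<subseteq> closure J"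
  proof
    fix e assume "e \<in> I"
    show "e \<in> closure J"
    proof (rule ccontr)
      assume "e \<notin> closure J"
      then have J: "e \<notin> J" "indep (insert e J)"
        using not_in_closure \<open>e \<in> I\<close> indep_ground[OF assms(1)] by blast+
      have "card (insert e J) \<le> card I"
        using card_le_closure[OF assms(1) J(2)] assms(3) \<open>e \<in> I\<close> subset_closure[OF assms(1)] by blast
      then show False
        using assms(4) J(1) finite_indep[OF assms(2)] by simp
    qed
  qed
  then show "closure I \<subseteq> closure J"
    using closure_mono assms by blast
qed

text \<open>The closure has rank one too small to contain a basis, so every basis meets its
  complement. A proper subset of the complement misses some \<open>e\<close>, and
  \<open>insert e I\<close> is a basis disjoint from that subset.\<close>

lemma cocircuit_closure:
  assumes "indep I" "basis indep B" "card B = Suc (card I)"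
  shows "cocircuit E indep (E - closure I)"
  unfolding cocircuit_def circuit_def
proof (intro conjI allI impI)
  show "\<not> dual_indep E indep (E - closure I)"
  proof
    assume "dual_indep E indep (E - closure I)"
    then obtain B' where B': "basis indep B'" "E - closure I \<subseteq> E - B'"
      unfolding dual_indep_def by blast
    then have "indep B'" "B' \<subseteq> closure I"
      using indep_ground unfolding basis_def by blast+
    moreover have "card B \<le> card B'"
      using card_le_basis[OF _ B'(1)] assms(2) unfolding basis_def by blast
    ultimately show False
      using card_le_closure[OF assms(1)] assms(3) by fastforce
  qed
next
  fix D assume "D \<subset> E - closure I"
  then obtain e where e: "e \<in> E" "e \<notin> closure I" "e \<notin> D" and D: "D \<subseteq> E - closure I" by blast
  then have "e \<notin> I" "indep (insert e I)"
    using not_in_closure by blast+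
  then have "basis indep (insert e I)"
    using basis_if_card[OF _ assms(2)] finite_indep[OF assms(1)] assms(3) by simp
  moreover have "D \<subseteq> E - insert e I"
    using D e subset_closure[OF assms(1)] by blast
  ultimately show "dual_indep E indep D"
    unfolding dual_indep_def by blast
qed blast

lemma card_basis_eq: "basis indep B \<Longrightarrow> basis indep B' \<Longrightarrow> card B = card B'"
  using card_le_basis[of B B'] card_le_basis[of B' B] unfolding basis_def by fastforce

lemma basis_dual_iff: "basis (dual_indep E indep) B \<longleftrightarrow> B \<subseteq> E \<and> basis indep (E - B)"
proof
  assume B: "basis (dual_indep E indep) B"
  then obtain B' where B': "basis indep B'" "B \<subseteq> E - B'"
    unfolding basis_def[of "dual_indep E indep"] dual_indep_def by blast
  then have "dual_indep E indep (E - B')"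
    unfolding dual_indep_def by blast
  then have "E - B' = B"
    using B B'(2) unfolding basis_def[of "dual_indep E indep"] by blast
  moreover have "B' \<subseteq> E"
    using B'(1) indep_ground unfolding basis_def by blast
  ultimately show "B \<subseteq> E \<and> basis indep (E - B)"
    using B'(1) by (metis Diff_subset double_diff subset_refl)
next
  assume B: "B \<subseteq> E \<and> basis indep (E - B)"
  show "basis (dual_indep E indep) B"
    unfolding basis_def[of "dual_indep E indep"]
  proof (intro conjI allI impI)
    show "dual_indep E indep B"
      using B unfolding dual_indep_def by blast
    fix Z assume "dual_indep E indep Z" "B \<subseteq> Z"
    then obtain B' where B': "basis indep B'" "Z \<subseteq> E - B'"
      unfolding dual_indep_def by blast
    then have "B' \<subseteq> E - B"
      using \<open>B \<subseteq> Z\<close> indep_ground unfolding basis_def by blast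
    then have "E - B = B'"
      using B B'(1) unfolding basis_def by blast
    then show "Z = B"
      using B B'(2) \<open>B \<subseteq> Z\<close> by blast
  qed
qed

lemma dual_dual: "dual_indep E (dual_indep E indep) = indep"
proof
  fix Z
  show "dual_indep E (dual_indep E indep) Z = indep Z"
  proof
    assume "dual_indep E (dual_indep E indep) Z"
    then obtain B where "basis (dual_indep E indep) B" "Z \<subseteq> E - B"
      unfolding dual_indep_def[of E "dual_indep E indep"] by blast
    then show "indep Z"
      using basis_dual_iff indep_subset unfolding basis_def[of indep] by blast
  next
    assume Z: "indep Z"
    obtain A where "basis indep A"
      using basis_exists by blast
    from extend_to_basis[OF Z this] obtain B where B: "basis indep B" "Z \<subseteq> B" .
    then have "B \<subseteq> E"
      using indep_ground unfolding basis_def by blast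
    then have "E - (E - B) = B" by blast
    then have "basis (dual_indep E indep) (E - B)" "Z \<subseteq> E - (E - B)"
      using B basis_dual_iff[of "E - B"] by simp_all
    then show "dual_indep E (dual_indep E indep) Z"
      unfolding dual_indep_def[of E "dual_indep E indep"] by blast
  qed
qed

lemma cocircuit_dual: "cocircuit E (dual_indep E indep) C \<longleftrightarrow> circuit E indep C"
  unfolding cocircuit_def dual_dual ..

lemma cci_dual: "cci E (dual_indep E indep) Z \<longleftrightarrow> cci E indep Z"
  unfolding cci_def cocircuit_dual unfolding cocircuit_def by (simp add: Int_commute) blast

lemma card_circuit_le:
  assumes "circuit E indep C" "basis indep B"
  shows "card C \<le> Suc (card B)"
proof -
  have "C \<noteq> {}"
    using assms(1) indep_empty unfolding circuit_def by metis
  then obtain c where c: "c \<in> C" by blast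
  then have "indep (C - {c})"
    using assms(1) unfolding circuit_def by blast
  then have "card (C - {c}) \<le> card B"
    using card_le_basis assms(2) by blast
  then show ?thesis
    using card_Diff_singleton[OF c] by linarith
qed

end

section \<open>Hyperplanes in an envelope\<close>

text \<open>A hypothetical counterexample, in which \<open>X\<close> is both the circuit and the
  cocircuit. Complementation in \<open>E\<close> exchanges \<open>basisX\<close> and
  \<open>basisY\<close>, which makes the locale self-dual.\<close>

locale envelope = matroid E indep
  for E :: "'a set" and indep :: "'a set \<Rightarrow> bool" +
  fixes X Y :: "'a set"
  assumes ground: "E = X \<union> Y"
    and disj: "X \<inter> Y = {}"
    and cardX: "card X = 7"
    and cardY: "card Y = 5"
    and basisX: "x \<in> X \<Longrightarrow> basis indep (X - {x})"
    and basisY: "x \<in> X \<Longrightarrow> basis indep (insert x Y)"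
    and no_cci: "cci E indep Z \<Longrightarrow> card Z \<noteq> 5"
begin

lemma finX: "finite X" and finY: "finite Y"
  by (metis cardX cardY card.infinite zero_neq_numeral)+

lemma X_nonempty: "X \<noteq> {}"
  using cardX by auto

lemma card_basis: "basis indep B \<Longrightarrow> card B = 6"
proof -
  assume B: "basis indep B"
  obtain x where "x \<in> X" using X_nonempty by blast
  then show ?thesis
    using card_basis_eq[OF B basisX] cardX by simp
qed

lemma indepX: "x \<in> X \<Longrightarrow> indep (X - {x})" and indepY: "x \<in> X \<Longrightarrow> indep (insert x Y)"
  using basisX basisY unfolding basis_def by blast+

lemma circuitX: "circuit E indep X"
  unfolding circuit_def
proof (intro conjI allI impI)
  show "\<not> indep X"
  proof
    assume "indep X"
    then have "card X \<le> 6"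
      using card_le_basis basis_exists card_basis by metis
    then show False using cardX by simp
  qed
  fix D assume "D \<subset> X"
  then obtain x where "x \<in> X" "D \<subseteq> X - {x}" by blast
  then show "indep D"
    using indepX indep_subset by blast
qed (use ground in blast)

definition hyperplane :: "'a set \<Rightarrow> bool" where
  "hyperplane H \<longleftrightarrow> (\<exists>I. indep I \<and> card I = 5 \<and> H = closure I)"

lemma hyperplane_closure: "indep I \<Longrightarrow> card I = 5 \<Longrightarrow> hyperplane (closure I)"
  unfolding hyperplane_def by metis

lemma cocircuit_hyperplane: "hyperplane H \<Longrightarrow> cocircuit E indep (E - H)"
proof -
  assume "hyperplane H"
  then obtain I where I: "indep I" "card I = 5" "H = closure I"
    unfolding hyperplane_def by blast
  obtain B where B: "basis indep B"
    using basis_exists by blast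
  then have "card B = Suc (card I)"
    using card_basis I(2) by simp
  then show ?thesis
    using cocircuit_closure I B by blast
qed

lemma hyperplane_eqI:
  assumes "hyperplane H" "hyperplane K" "indep J" "card J = 5" "J \<subseteq> H" "J \<subseteq> K"
  shows "H = K"
  using assms closure_eq unfolding hyperplane_def by metis

lemma card_le_hyperplane: "hyperplane H \<Longrightarrow> indep J \<Longrightarrow> J \<subseteq> H \<Longrightarrow> card J \<le> 5"
  using card_le_closure unfolding hyperplane_def by metis

text \<open>\<open>C - H\<close> is the intersection of \<open>C\<close> with the cocircuit
  \<open>E - H\<close>, so \<open>no_cci\<close> restricts its size.\<close>

lemma card_circuit_hyperplane:
  assumes "circuit E indep C" "hyperplane H"
  shows "card (C - H) \<noteq> 5"
proof -
  have "C - H = C \<inter> (E - H)"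
    using assms(1) unfolding circuit_def by blast
  then show ?thesis
    using no_cci assms cocircuit_hyperplane unfolding cci_def by metis
qed

text \<open>A trace of size 2 would leave five elements of the circuit \<open>X\<close> off
  \<open>H\<close>. Any six elements of \<open>X\<close> are independent, so a hyperplane, having
  rank 5, cannot hold six.\<close>

lemma card_trace:
  assumes "hyperplane H"
  shows "card (X \<inter> H) \<noteq> 2" and "card (X \<inter> H) \<le> 5"
proof -
  have "card (X - H) \<noteq> 5"
    using card_circuit_hyperplane[OF circuitX assms] .
  then show "card (X \<inter> H) \<noteq> 2"
    using cardX card_Diff_subset_Int[of X H] finX by auto
  \<comment> \<open>One witness for both cases below: any element of \<open>X\<close>, but one
    outside \<open>H\<close> if there is such an element.\<close>
  obtain x where x: "x \<in> X" "X \<inter> H \<noteq> X \<Longrightarrow> x \<notin> H"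
    using X_nonempty by blast
  show "card (X \<inter> H) \<le> 5"
  proof (cases "X \<subseteq> H")
    case True
    then have "card (X - {x}) \<le> 5"
      using card_le_hyperplane[OF assms indepX[OF x(1)]] by blast
    then show ?thesis using x(1) cardX by simp
  next
    case False
    then have "X \<inter> H \<subseteq> X - {x}"
      using x by blast
    then have "indep (X \<inter> H)"
      using indep_subset[OF indepX[OF x(1)]] by blast
    then show ?thesis
      using card_le_hyperplane[OF assms] by blast
  qed
qed

text \<open>The intersection of two distinct hyperplanes has rank at most 4, so by submodularity two such
  intersections that share rank 3 span rank at most 5.\<close>
lemma two_lines:
  assumes H: "hyperplane H1" "hyperplane H2" "H1 \<noteq> H2" "hyperplane H3" "hyperplane H4" "H3 \<noteq> H4"
    and I: "indep I" "card I = 3" "I \<subseteq> H1 \<inter> H2" "I \<subseteq> H3 \<inter> H4"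
    and x: "x \<in> X"
  shows "\<not> X - {x} \<subseteq> (H1 \<inter> H2) \<union> (H3 \<inter> H4)"
proof
  assume sub: "X - {x} \<subseteq> (H1 \<inter> H2) \<union> (H3 \<inter> H4)"
  have four: "card J \<le> 4" if "hyperplane H" "hyperplane K" "H \<noteq> K" "indep J" "J \<subseteq> H \<inter> K" for H K J
  proof (rule ccontr)
    assume "\<not> card J \<le> 4"
    moreover have "card J \<le> 5"
      using card_le_hyperplane[OF that(1,4)] that(5) by blast
    ultimately show False
      using hyperplane_eqI[OF that(1,2,4)] that(3,5) by force
  qed
  \<comment> \<open>\<open>F\<close> will be a maximal independent set between \<open>I\<close> and
    \<open>H1 \<inter> H2\<close>. By maximality, the elements of \<open>X - {x}\<close> that extend
    it lie outside that intersection, hence in the other one.\<close>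
  define S where "S = {J. indep J \<and> I \<subseteq> J \<and> J \<subseteq> H1 \<inter> H2}"
  have "S \<subseteq> Pow E"
    unfolding S_def using indep_ground by blast
  then have "finite S"
    using finite_ground finite_subset by blast
  moreover have "I \<in> S" unfolding S_def using I by blast
  ultimately obtain F where F: "F \<in> S" "\<And>J. J \<in> S \<Longrightarrow> F \<subseteq> J \<Longrightarrow> F = J"
    using finite_has_maximal[of S] by blast
  then have F': "indep F" "I \<subseteq> F" "F \<subseteq> H1 \<inter> H2" unfolding S_def by auto
  obtain B where B: "indep B" "F \<subseteq> B" "B \<subseteq> F \<union> (X - {x})" "card (X - {x}) \<le> card B"
    using extend_indep[OF F'(1) indepX[OF x]] .
  have "B - F \<subseteq> H3 \<inter> H4"
  proof
    fix b assume b: "b \<in> B - F"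
    have "b \<notin> H1 \<inter> H2"
    proof
      assume "b \<in> H1 \<inter> H2"
      then have "insert b F \<in> S"
        unfolding S_def using F' indep_subset[OF B(1), of "insert b F"] B(2) b by auto
      then show False using F(2) b by blast
    qed
    then show "b \<in> H3 \<inter> H4" using b B(3) sub by blast
  qed
  \<comment> \<open>Hence \<open>B - F\<close> has at most one element, and \<open>F\<close> has at
    most four, whereas \<open>B\<close> has at least six.\<close>
  then have "card (I \<union> (B - F)) \<le> 4"
    using four[OF H(4-6) indep_subset[OF B(1)], of "I \<union> (B - F)"] I(4) F'(2) B(2) by blast
  moreover have "card (I \<union> (B - F)) = card I + card (B - F)"
    using F'(2) finite_indep[OF I(1)] finite_indep[OF B(1)] by (intro card_Un_disjoint) auto
  moreover have "card (B - F) = card B - card F"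
    using card_Diff_subset[OF finite_indep[OF F'(1)] B(2)] .
  moreover have "card F \<le> 4"
    using four[OF H(1-3) F'(1,3)] .
  ultimately show False
    using B(4) I(2) cardX x by simp
qed

subsection \<open>The partition of X belonging to an element of Y\<close>

text \<open>\<open>Y\<close> itself is a hyperplane; for \<open>y\<close> in \<open>Y\<close> and
  \<open>a\<close> in \<open>X\<close> these are the other hyperplanes through
  \<open>Y - {y}\<close>.\<close>

definition hyp :: "'a \<Rightarrow> 'a \<Rightarrow> 'a set" where
  "hyp y a = closure (insert a (Y - {y}))"

definition block :: "'a \<Rightarrow> 'a \<Rightarrow> 'a set" where
  "block y a = X \<inter> hyp y a"

lemma hyp_base:
  assumes "y \<in> Y" "a \<in> X"
  shows "indep (insert a (Y - {y}))" "card (insert a (Y - {y})) = 5"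
proof -
  show "indep (insert a (Y - {y}))"
    by (rule indep_subset[OF indepY[OF assms(2)]]) blast
  show "card (insert a (Y - {y})) = 5"
  proof -
    have "a \<notin> Y - {y}" using assms disj by blast
    then show ?thesis
      using assms(1) finY cardY by simp
  qed
qed

lemma hyp_props:
  assumes "y \<in> Y" "a \<in> X"
  shows "hyperplane (hyp y a)" "a \<in> hyp y a" "Y - {y} \<subseteq> hyp y a" "y \<notin> hyp y a"
proof -
  show h: "hyperplane (hyp y a)"
    unfolding hyp_def by (rule hyperplane_closure[OF hyp_base[OF assms]])
  show a: "a \<in> hyp y a" "Y - {y} \<subseteq> hyp y a"
    using subset_closure[OF hyp_base(1)[OF assms]] unfolding hyp_def by blast+
  show "y \<notin> hyp y a"
  proof
    assume "y \<in> hyp y a"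
    then have "insert a Y \<subseteq> hyp y a" using a assms by blast
    then show False
      using card_le_hyperplane[OF h indepY[OF assms(2)]] card_basis[OF basisY[OF assms(2)]] by simp
  qed
qed

text \<open>The five independent elements of \<open>insert a (Y - {y})\<close> determine the
  hyperplane; this is why the blocks of one \<open>y\<close> partition \<open>X\<close>.\<close>

lemma hyp_unique:
  assumes "y \<in> Y" "a \<in> X" "hyperplane H" "a \<in> H" "Y - {y} \<subseteq> H"
  shows "hyp y a = H"
  using hyperplane_eqI[OF hyp_props(1)[OF assms(1,2)] assms(3) hyp_base[OF assms(1,2)]]
    hyp_props[OF assms(1,2)] assms(4,5) by blast

lemma block_self: "y \<in> Y \<Longrightarrow> a \<in> X \<Longrightarrow> a \<in> block y a"
  using hyp_props unfolding block_def by blast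

lemma block_eq:
  assumes "y \<in> Y" "a \<in> X" "b \<in> block y a"
  shows "block y b = block y a"
proof -
  have "hyp y b = hyp y a"
    using assms hyp_props[OF assms(1,2)] hyp_unique[OF assms(1)] unfolding block_def by blast
  then show ?thesis unfolding block_def by simp
qed

lemma block_subset: "block y a \<subseteq> X"
  unfolding block_def by blast

lemma card_block:
  assumes "y \<in> Y" "a \<in> X"
  shows "card (block y a) \<in> {1,3,4,5}"
proof -
  have "card (block y a) \<noteq> 2" "card (block y a) \<le> 5"
    using card_trace[OF hyp_props(1)[OF assms]] unfolding block_def by auto
  moreover have "card (block y a) \<noteq> 0"
    using block_self[OF assms] finX block_subset[of y a] finite_subset by (auto simp: card_eq_0_iff)
  ultimately show ?thesis by auto
qed

lemma indep_pair:
  assumes "y \<in> Y" "a \<in> X" "b \<in> X" "b \<notin> block y a"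
  shows "indep (insert b (insert a (Y - {y})))"
  using not_in_closure[of b "insert a (Y - {y})"] assms ground unfolding block_def hyp_def by blast

lemma card_pair:
  assumes "y \<in> Y" "z \<in> Y" "y \<noteq> z" "a \<in> X" "b \<in> X" "a \<noteq> b"
  shows "card (insert b (insert a (Y - {y,z}))) = 5"
proof -
  have "card (Y - {y,z}) = 3" using assms cardY finY by (simp add: card_Diff_subset)
  moreover have "a \<notin> Y" "b \<notin> Y" using assms disj by auto
  ultimately show ?thesis using assms(6) finY by simp
qed

text \<open>In the rank-3 contraction by all of Y except two elements y and z, the blocks of y and of z
  are the lines through z and through y. A line spanned by two points that share neither a row nor
  a column of this grid meets every row and every column in at most one cell, and contains
  each cell that it meets.\<close>
lemma transversal:
  assumes yz: "y \<in> Y" "z \<in> Y" "y \<noteq> z" and ab: "a \<in> X" "b \<in> X" "b \<notin> block y a" "b \<notin> block z a"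
  obtains H where "hyperplane H" "y \<notin> H" "z \<notin> H" "Y - {y,z} \<subseteq> H" "a \<in> H" "b \<in> H"
    "\<And>c d. c \<in> X \<Longrightarrow> d \<in> X \<Longrightarrow> c \<in> H \<Longrightarrow> d \<in> block y c \<Longrightarrow> d \<in> block z c \<Longrightarrow> d \<in> H"
    "\<And>c d. c \<in> X \<Longrightarrow> d \<in> X \<Longrightarrow> c \<in> H \<Longrightarrow> d \<in> H \<Longrightarrow> d \<in> block y c \<longleftrightarrow> d \<in> block z c"
proof -
  define J where "J = insert b (insert a (Y - {y,z}))"
  have J: "indep J"
    unfolding J_def by (rule indep_subset[OF indep_pair[OF yz(1) ab(1-3)]]) blast
  have "a \<noteq> b" using ab block_self yz by metis
  then have cJ: "card J = 5"
    unfolding J_def using card_pair yz ab by metis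
  define H where "H = closure J"
  have H: "hyperplane H" unfolding H_def by (rule hyperplane_closure[OF J cJ])
  have JH: "J \<subseteq> H" unfolding H_def using subset_closure[OF J] .
  then have aH: "a \<in> H" and bH: "b \<in> H" and YH: "Y - {y,z} \<subseteq> H"
    unfolding J_def by blast+
  \<comment> \<open>If \<open>H\<close> contained one of \<open>y\<close> and \<open>z\<close>, it
    would be the hyperplane of the other one through \<open>a\<close>, and \<open>b\<close> would
    share that block with \<open>a\<close>.\<close>
  have avoid: "w \<notin> H" if vw: "w = y \<and> v = z \<or> w = z \<and> v = y" for v w
  proof
    assume "w \<in> H"
    then have "Y - {v} \<subseteq> H" using YH vw by blast
    then have "hyp v a = H"
      using hyp_unique[OF _ ab(1) H aH, of v] yz vw by metis
    then have "b \<in> block v a"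
      unfolding block_def using ab bH by simp
    then show False using ab vw by metis
  qed
  have y: "y \<notin> H" and z: "z \<notin> H" using avoid by metis+
  \<comment> \<open>The distinct hyperplanes \<open>hyp y c\<close> and \<open>hyp z c\<close> meet
    in the rank-4 closure of \<open>I\<close>, which contains \<open>d\<close> and lies in
    \<open>H\<close>.\<close>
  have cell: "d \<in> H" if cd: "c \<in> X" "d \<in> X" "c \<in> H" "d \<in> block y c" "d \<in> block z c" for c d
  proof -
    note py = hyp_props[OF yz(1) cd(1)] and pz = hyp_props[OF yz(2) cd(1)]
    define I where "I = insert c (Y - {y,z})"
    have I: "indep I"
      unfolding I_def by (rule indep_subset[OF indepY[OF cd(1)]]) blast
    have "d \<in> closure I"
    proof (rule ccontr)
      assume "d \<notin> closure I"
      moreover have "d \<in> E" using cd(2) ground by simp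
      ultimately have d: "d \<notin> I" "indep (insert d I)"
        using not_in_closure by simp_all
      have "card (insert d I) = 5"
        using card_pair[OF yz cd(1,2)] d(1) unfolding I_def by blast
      moreover have "insert d I \<subseteq> hyp y c" "insert d I \<subseteq> hyp z c"
        using cd(4,5) py(2,3) pz(2,3) unfolding I_def block_def by blast+
      ultimately have "hyp y c = hyp z c"
        using hyperplane_eqI[OF py(1) pz(1) d(2)] by simp
      moreover have "y \<in> hyp z c" using pz(3) yz by blast
      ultimately show False using py(4) by simp
    qed
    moreover have "I \<subseteq> closure J"
      using JH cd(3) unfolding H_def I_def J_def by blast
    ultimately show ?thesis
      unfolding H_def using closure_mono[OF I J] by blast
  qed
  \<comment> \<open>If \<open>c\<close> and \<open>d\<close> share a block of \<open>v\<close> but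
    none of \<open>w\<close>, then \<open>K\<close> is an independent 5-set common to
    \<open>H\<close> and \<open>hyp v c\<close>. These hyperplanes then coincide, which puts
    \<open>w\<close> into \<open>H\<close>.\<close>
  have tr: "d \<in> block w c"
    if cd: "c \<in> X" "d \<in> X" "c \<in> H" "d \<in> H" "d \<in> block v c" and vw: "w = y \<and> v = z \<or> w = z \<and> v = y"
    for c d v w
  proof (rule ccontr)
    assume n: "d \<notin> block w c"
    have w: "w \<in> Y" "v \<in> Y" "w \<noteq> v" using vw yz by auto
    note p = hyp_props[OF w(2) cd(1)]
    define K where "K = insert d (insert c (Y - {w,v}))"
    have "c \<noteq> d" using n block_self[OF w(1) cd(1)] by metis
    then have cK: "card K = 5"
      unfolding K_def using card_pair w cd by metis
    have K: "indep K"
      unfolding K_def by (rule indep_subset[OF indep_pair[OF w(1) cd(1,2) n]]) blast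
    have "K \<subseteq> H" using cd YH vw unfolding K_def by blast
    moreover have "K \<subseteq> hyp v c" using cd p unfolding K_def block_def by blast
    ultimately have "H = hyp v c"
      using hyperplane_eqI[OF H p(1) K cK] by simp
    moreover have "w \<in> hyp v c" using p(3) w by blast
    ultimately show False using avoid vw by metis
  qed
  show ?thesis
  proof (rule that[OF H y z YH aH bH cell])
    fix c d assume cd: "c \<in> X" "d \<in> X" "c \<in> H" "d \<in> H"
    show "d \<in> block y c \<longleftrightarrow> d \<in> block z c"
      using tr[OF cd, of y z] tr[OF cd, of z y] by metis
  qed
qed

section \<open>Types of the partitions\<close>

definition sing :: "'a \<Rightarrow> 'a \<Rightarrow> bool" where
  "sing y x \<longleftrightarrow> x \<in> X \<and> block y x = {x}"

definition type43 :: "'a \<Rightarrow> 'a set \<Rightarrow> bool" where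
  "type43 y B \<longleftrightarrow> B \<subseteq> X \<and> card B = 3 \<and> (\<forall>a\<in>B. block y a = B) \<and> (\<forall>a\<in>X - B. block y a = X - B)"

definition type331 :: "'a \<Rightarrow> 'a \<Rightarrow> 'a set \<Rightarrow> 'a set \<Rightarrow> bool" where
  "type331 y x U V \<longleftrightarrow> sing y x \<and> X = insert x (U \<union> V) \<and> x \<notin> U \<and> x \<notin> V \<and> U \<inter> V = {} \<and>
    card U = 3 \<and> card V = 3 \<and> (\<forall>a\<in>U. block y a = U) \<and> (\<forall>a\<in>V. block y a = V)"

lemma type331_commute: "type331 y x U V \<Longrightarrow> type331 y x V U"
  unfolding type331_def by (auto simp: Un_commute)

text \<open>A singleton block means that the hyperplane is just \<open>insert x (Y - {y})\<close>;
  the cocircuit is its complement.\<close>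

lemma sing_cocircuit:
  assumes "y \<in> Y" "sing y x"
  shows "cocircuit E indep (insert y X - {x})"
proof -
  have x: "x \<in> X" "X \<inter> hyp y x = {x}" using assms unfolding sing_def block_def by auto
  have "E - hyp y x = insert y X - {x}"
    using x hyp_props[OF assms(1) x(1)] assms(1) ground disj by blast
  then show ?thesis
    using cocircuit_hyperplane[OF hyp_props(1)[OF assms(1) x(1)]] by simp
qed

lemma card_block_not_sing:
  assumes "y \<in> Y" "a \<in> X" "\<not> sing y a"
  shows "card (block y a) \<ge> 3"
proof -
  have "card (block y a) \<noteq> 1"
    using block_self[OF assms(1,2)] assms unfolding sing_def by (metis card_1_singletonE singletonD)
  then show ?thesis using card_block[OF assms(1,2)] by auto
qed

lemma block_disjoint:
  assumes "y \<in> Y" "a \<in> X" "b \<in> X" "b \<notin> block y a"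
  shows "block y a \<inter> block y b = {}"
proof (rule ccontr)
  assume "block y a \<inter> block y b \<noteq> {}"
  then obtain c where "c \<in> block y a" "c \<in> block y b" by blast
  then have "block y b = block y a"
    using block_eq assms by metis
  then show False
    using block_self[OF assms(1,3)] assms(4) by simp
qed
text \<open>All blocks have between 3 and 5 elements, and 7 splits into such parts only as
  4+3.\<close>

lemma obtain_type43:
  assumes y: "y \<in> Y" and n: "\<And>x. \<not> sing y x"
  obtains B where "type43 y B"
proof -
  \<comment> \<open>Applied to an arbitrary block and, if that has size 3, once more to the block of
    size 4 that it yields.\<close>
  have key: "card A \<le> 4 \<and> (card A = 4 \<longrightarrow> type43 y (X - A)) \<and> (card A = 3 \<longrightarrow> (\<exists>b\<in>X. card (block y b) = 4))"
    if a: "a \<in> X" "A = block y a" for a A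
  proof -
    have A: "A \<subseteq> X" "finite A" using a block_subset finX finite_subset by blast+
    then have c: "card (X - A) = 7 - card A" using cardX by (simp add: card_Diff_subset)
    moreover have "card A \<le> 5" using card_block[OF y a(1)] a(2) by auto
    ultimately have "X - A \<noteq> {}" by force
    then obtain b where b: "b \<in> X" "b \<notin> A" by blast
    have sub: "block y c \<subseteq> X - A" if "c \<in> X" "c \<notin> A" for c
      using block_disjoint[OF y a(1)] that a(2) block_subset by blast
    have le: "3 \<le> card (block y c)" "card (block y c) \<le> 7 - card A" if "c \<in> X" "c \<notin> A" for c
      using card_block_not_sing[OF y that(1) n] card_mono[OF _ sub[OF that]] finX c by auto
    have A4: "card A \<le> 4" using le[OF b] by linarith
    moreover have "type43 y (X - A)" if "card A = 4"
    proof -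
      have "card (X - A) = 3" using c that by simp
      moreover have "block y d = X - A" if "d \<in> X - A" for d
        using card_subset_eq[OF _ sub] le[of d] that \<open>card (X - A) = 3\<close> finX \<open>card A = 4\<close> by force
      moreover have "block y d = A" if "d \<in> A" for d
        using block_eq[OF y a(1)] a(2) that by blast
      ultimately show ?thesis
        unfolding type43_def using A by (simp add: double_diff)
    qed
    moreover have "\<exists>b\<in>X. card (block y b) = 4" if "card A = 3"
    proof (rule ccontr)
      \<comment> \<open>Then a second block of size 3 leaves a single element of \<open>X\<close>,
        whose block would be a singleton.\<close>
      assume no: "\<not> (\<exists>b\<in>X. card (block y b) = 4)"
      have "card (block y b) = 3" using le[OF b] no b(1) that by force
      then have "card (X - A - block y b) = 1"
        using sub[OF b] c that finX finite_subset[OF block_subset finX] by (simp add: card_Diff_subset)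
      then obtain d where d: "X - A - block y b = {d}" by (metis card_1_singletonE)
      then have dX: "d \<in> X" "d \<notin> A" "d \<notin> block y b" by auto
      have "block y d \<subseteq> X - A - block y b"
        using sub[OF dX(1,2)] block_disjoint[OF y b(1) dX(1,3)] by blast
      then have "block y d \<subseteq> {d}" using d by simp
      then show False
        using le(1)[OF dX(1,2)] card_mono[of "{d}" "block y d"] by simp
    qed
    ultimately show ?thesis by blast
  qed
  obtain a where a: "a \<in> X" using X_nonempty by blast
  have "3 \<le> card (block y a)" using card_block_not_sing[OF y a n] .
  then have "card (block y a) = 3 \<or> card (block y a) = 4" using key[OF a refl] by linarith
  then obtain b where "b \<in> X" "card (block y b) = 4" using key[OF a refl] a by blast
  then show ?thesis using key that by blast
qed

text \<open>The six elements other than \<open>x\<close> lie in blocks of size at least 3. A block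
  of all six is too large, so they split 3+3.\<close>

lemma obtain_type331:
  assumes y: "y \<in> Y" and x: "sing y x" and uniq: "\<And>x'. sing y x' \<Longrightarrow> x' = x"
  obtains U V where "type331 y x U V"
proof -
  have xX: "x \<in> X" "block y x = {x}" using x unfolding sing_def by auto
  have avoid: "x \<notin> block y a" if "a \<in> X" "a \<noteq> x" for a
    using block_eq[OF y that(1)] block_self[OF y that(1)] that xX by blast
  have c6: "card (X - {x}) = 6" using cardX xX by simp
  then have "X - {x} \<noteq> {}" by force
  then obtain a where a: "a \<in> X" "a \<noteq> x" by blast
  define U where "U = block y a"
  have U: "U \<subseteq> X - {x}" "finite U"
    unfolding U_def using avoid[OF a] block_subset finX finite_subset by blast+
  then have cV: "card (X - {x} - U) = 6 - card U" using c6 by (simp add: card_Diff_subset)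
  have U3: "3 \<le> card U" unfolding U_def using card_block_not_sing[OF y a(1)] uniq a by blast
  have "card U \<le> 5" unfolding U_def using card_block[OF y a(1)] by auto
  then have "X - {x} - U \<noteq> {}" using cV by force
  then obtain v where v: "v \<in> X" "v \<noteq> x" "v \<notin> U" by blast
  have sub: "block y d \<subseteq> X - {x} - U" if "d \<in> X" "d \<noteq> x" "d \<notin> U" for d
    using block_disjoint[OF y a(1) that(1)] that avoid[OF that(1,2)] block_subset unfolding U_def by blast
  have le: "3 \<le> card (block y d)" "card (block y d) \<le> 6 - card U" if "d \<in> X" "d \<noteq> x" "d \<notin> U" for d
    using card_block_not_sing[OF y that(1)] uniq that card_mono[OF _ sub[OF that]] finX cV by auto
  have cU: "card U = 3" using le[OF v] U3 by linarith
  have V: "block y d = X - {x} - U" if "d \<in> X - {x} - U" for d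
    using card_subset_eq[OF _ sub[of d]] le[of d] that cU cV finX by force
  have "type331 y x U (X - {x} - U)"
    unfolding type331_def
  proof (intro conjI ballI)
    show "X = insert x (U \<union> (X - {x} - U))" using U(1) xX by blast
    show "card (X - {x} - U) = 3" using cU cV by simp
    show "block y d = U" if "d \<in> U" for d
      using block_eq[OF y a(1)] that unfolding U_def by simp
  qed (use x U cU V in blast)+
  then show ?thesis using that by blast
qed

subsection \<open>Interaction of two or more partitions\<close>

lemma type43_card_compl: "type43 y B \<Longrightarrow> card (X - B) = 4"
  unfolding type43_def using cardX finX card_Diff_subset[of B X] finite_subset[of B X] by simp

lemma type43_block: "type43 y B \<Longrightarrow> a \<in> X \<Longrightarrow> b \<in> X \<Longrightarrow> b \<in> block y a \<longleftrightarrow> (b \<in> B \<longleftrightarrow> a \<in> B)"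
  unfolding type43_def by (cases "a \<in> B") auto

text \<open>In the two-by-two grid of the partitions, \<open>B - C\<close> and \<open>C - B\<close>
  are opposite cells. The transversal through a point of each fills exactly these two.\<close>

lemma type43_line:
  assumes yz: "y \<in> Y" "z \<in> Y" "y \<noteq> z" and B: "type43 y B" and C: "type43 z C" and ne: "B \<noteq> C"
  obtains H where "hyperplane H" "y \<notin> H" "z \<notin> H" "Y - {y,z} \<subseteq> H" "X \<inter> H = (B - C) \<union> (C - B)"
proof -
  have sub: "B \<subseteq> X" "C \<subseteq> X" and c: "card B = 3" "card C = 3"
    using B C unfolding type43_def by auto
  then have fin: "finite B" "finite C" using finX finite_subset by metis+
  have "\<not> B \<subseteq> C" "\<not> C \<subseteq> B"
    using card_subset_eq[of B C] card_subset_eq[of C B] c fin ne by auto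
  then obtain a b where ab: "a \<in> B" "a \<notin> C" "b \<in> C" "b \<notin> B" by blast
  then have X: "a \<in> X" "b \<in> X" using sub by blast+
  note bl = type43_block[OF B] type43_block[OF C]
  have "b \<notin> block y a" "b \<notin> block z a"
    using bl X ab by simp_all
  from transversal[OF yz X this] obtain H where H: "hyperplane H" "y \<notin> H" "z \<notin> H" "Y - {y,z} \<subseteq> H"
    "a \<in> H" "b \<in> H"
    "\<And>c d. c \<in> X \<Longrightarrow> d \<in> X \<Longrightarrow> c \<in> H \<Longrightarrow> d \<in> block y c \<Longrightarrow> d \<in> block z c \<Longrightarrow> d \<in> H"
    "\<And>c d. c \<in> X \<Longrightarrow> d \<in> X \<Longrightarrow> c \<in> H \<Longrightarrow> d \<in> H \<Longrightarrow> d \<in> block y c \<longleftrightarrow> d \<in> block z c"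
    by metis
  have "X \<inter> H = (B - C) \<union> (C - B)"
  proof (intro equalityI subsetI)
    fix c assume "c \<in> X \<inter> H"
    then show "c \<in> (B - C) \<union> (C - B)"
      using H(8)[OF X(1), of c] bl X ab H(5) by auto
  next
    fix c assume "c \<in> (B - C) \<union> (C - B)"
    then show "c \<in> X \<inter> H"
      using H(7)[OF X(1), of c] H(7)[OF X(2), of c] bl X ab H(5,6) sub by auto
  qed
  then show ?thesis using that H by metis
qed

text \<open>If \<open>B = C\<close>, a transversal would contain all of \<open>X\<close>. Otherwise
  the line of \<open>type43_line\<close> has a trace of size 6, 4 or 2 according as the intersection
  has 0, 1 or 2 elements, and \<open>card_trace\<close> leaves only 4.\<close>

lemma type43_inter:
  assumes yz: "y \<in> Y" "z \<in> Y" "y \<noteq> z" and B: "type43 y B" and C: "type43 z C"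
  shows "card (B \<inter> C) = 1"
proof -
  have sub: "B \<subseteq> X" "C \<subseteq> X" and c: "card B = 3" "card C = 3"
    using B C unfolding type43_def by auto
  then have fin: "finite B" "finite C" using finX finite_subset by metis+
  have ne: "B \<noteq> C"
  proof
    assume "B = C"
    note bl = type43_block[OF B] type43_block[OF C[folded \<open>B = C\<close>]]
    have "B \<noteq> {}" using c by auto
    moreover have "X - B \<noteq> {}"
      using type43_card_compl[OF B] by (metis card.empty zero_neq_numeral)
    ultimately obtain a b where ab: "a \<in> X" "b \<in> X" "a \<in> B" "b \<notin> B" using sub by blast
    then have "b \<notin> block y a" "b \<notin> block z a"
      using bl by simp_all
    from transversal[OF yz ab(1,2) this] obtain H where H: "hyperplane H" "a \<in> H" "b \<in> H"
      "\<And>c d. c \<in> X \<Longrightarrow> d \<in> X \<Longrightarrow> c \<in> H \<Longrightarrow> d \<in> block y c \<Longrightarrow> d \<in> block z c \<Longrightarrow> d \<in> H"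
      by metis
    have "X \<subseteq> H"
    proof
      fix d assume "d \<in> X"
      then show "d \<in> H"
        using H(4)[OF ab(1), of d] H(4)[OF ab(2), of d] H(2,3) bl ab by auto
    qed
    then show False using card_trace(2)[OF H(1)] cardX by (simp add: Int_absorb2)
  qed
  obtain H where H: "hyperplane H" "X \<inter> H = (B - C) \<union> (C - B)"
    using type43_line[OF assms ne] by metis
  have "card (B - C) = 3 - card (B \<inter> C)" "card (C - B) = 3 - card (B \<inter> C)"
    using c fin by (simp_all add: card_Diff_subset_Int Int_commute)
  moreover have "card ((B - C) \<union> (C - B)) = card (B - C) + card (C - B)"
    using fin by (intro card_Un_disjoint) auto
  moreover have "B \<inter> C \<subset> B"
    using card_subset_eq[of C B] c fin ne by auto
  then have "card (B \<inter> C) < 3"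
    using psubset_card_mono[OF fin(1)] c by metis
  ultimately show ?thesis
    using card_trace[OF H(1)] H(2) by force
qed

text \<open>For a common point \<open>p\<close>, the three sets without \<open>p\<close> partition
  \<open>X - {p}\<close>. On \<open>X\<close>, the hyperplane \<open>H\<close> of \<open>y1\<close>,
  \<open>y2\<close> has the same trace as one of \<open>y3\<close>, and \<open>K\<close> of
  \<open>y2\<close>, \<open>y3\<close> the same as one of \<open>y1\<close>. The two intersections
  cover \<open>X - {p}\<close>, against \<open>two_lines\<close>.\<close>

lemma type43_triple:
  assumes Y: "y1 \<in> Y" "y2 \<in> Y" "y3 \<in> Y" "y1 \<noteq> y2" "y1 \<noteq> y3" "y2 \<noteq> y3"
    and B: "type43 y1 B1" "type43 y2 B2" "type43 y3 B3"
  shows "B1 \<inter> B2 \<inter> B3 = {}"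
proof (rule ccontr)
  assume "B1 \<inter> B2 \<inter> B3 \<noteq> {}"
  then obtain p where p: "p \<in> B1" "p \<in> B2" "p \<in> B3" by blast
  have single: "A = {p}" if "card A = 1" "p \<in> A" for A
    using that by (metis card_1_singletonE singletonD)
  have int: "B1 \<inter> B2 = {p}" "B1 \<inter> B3 = {p}" "B2 \<inter> B3 = {p}"
    using single[OF type43_inter[OF Y(1,2,4) B(1,2)]] single[OF type43_inter[OF Y(1,3,5) B(1,3)]]
      single[OF type43_inter[OF Y(2,3,6) B(2,3)]] p by blast+
  have sub: "B1 \<subseteq> X" "B2 \<subseteq> X" "B3 \<subseteq> X" and c: "card B1 = 3" "card B2 = 3" "card B3 = 3"
    using B unfolding type43_def by auto
  have fin: "finite B1" "finite B2" "finite B3" using sub finX finite_subset by metis+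
  have "card (B1 \<union> B2 \<union> B3) = 7"
  proof -
    have "card (B1 \<union> B2) = 5"
      using card_Un_Int[OF fin(1,2)] c int by simp
    moreover have "(B1 \<union> B2) \<inter> B3 = {p}" using int by blast
    ultimately show ?thesis
      using card_Un_Int[of "B1 \<union> B2" B3] fin c by simp
  qed
  then have X: "X = B1 \<union> B2 \<union> B3"
    using card_subset_eq[OF finX, of "B1 \<union> B2 \<union> B3"] sub cardX by simp
  have ne: "B1 \<noteq> B2" "B2 \<noteq> B3" using int c by auto
  obtain H where H: "hyperplane H" "y1 \<notin> H" "Y - {y1,y2} \<subseteq> H" "X \<inter> H = (B1 - B2) \<union> (B2 - B1)"
    using type43_line[OF Y(1,2,4) B(1,2) ne(1)] by metis
  obtain K where K: "hyperplane K" "y3 \<notin> K" "Y - {y2,y3} \<subseteq> K" "X \<inter> K = (B2 - B3) \<union> (B3 - B2)"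
    using type43_line[OF Y(2,3,6) B(2,3) ne(2)] by metis
  have "card (B2 - B1) = 2"
    using c fin int by (simp add: card_Diff_subset_Int Int_commute)
  then have "B2 - B1 \<noteq> {}" by force
  then obtain b where b: "b \<in> B2" "b \<notin> B1" by blast
  then have b': "b \<notin> B3" "b \<in> X" using int sub by blast+
  have h3: "X \<inter> hyp y3 b = X - B3" and h1: "X \<inter> hyp y1 b = X - B1"
    using B(1,3) b b' unfolding type43_def block_def by simp_all
  note p1 = hyp_props[OF Y(1) b'(2)] and p3 = hyp_props[OF Y(3) b'(2)]
  \<comment> \<open>\<open>b\<close> and the two remaining elements of \<open>Y\<close> give the
    rank 3 common to all four hyperplanes.\<close>
  define I where "I = insert b (Y - {y1,y2,y3})"
  have I: "indep I"
    unfolding I_def by (rule indep_subset[OF indepY[OF b'(2)]]) blast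
  have "card (Y - {y1,y2,y3}) = 2"
    using Y cardY finY by (simp add: card_Diff_subset)
  moreover have "b \<notin> Y" using b'(2) disj by blast
  ultimately have cI: "card I = 3"
    unfolding I_def using finY by simp
  have IH: "I \<subseteq> H \<inter> hyp y3 b"
    unfolding I_def using H(3,4) p3(2,3) b b' by blast
  have IK: "I \<subseteq> K \<inter> hyp y1 b"
    unfolding I_def using K(3,4) p1(2,3) b b' by blast
  have "H \<noteq> hyp y3 b" "K \<noteq> hyp y1 b"
    using H(2) p3(3) K(2) p1(3) Y by blast+
  moreover have "X - {p} \<subseteq> (H \<inter> hyp y3 b) \<union> (K \<inter> hyp y1 b)"
  proof
    fix q assume q: "q \<in> X - {p}"
    then consider "q \<in> B1" "q \<notin> B2" "q \<notin> B3" | "q \<in> B2" "q \<notin> B1" "q \<notin> B3" | "q \<in> B3" "q \<notin> B1" "q \<notin> B2"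
      using X int by blast
    then show "q \<in> (H \<inter> hyp y3 b) \<union> (K \<inter> hyp y1 b)"
      using q H(4) K(4) h1 h3 by cases blast+
  qed
  ultimately show False
    using two_lines[OF H(1) p3(1) _ K(1) p1(1) _ I cI IH IK, of p] sub p by blast
qed

text \<open>The pairwise intersections are six distinct points, three in each \<open>Bi\<close>. The
  symmetric differences of \<open>B1\<close>, \<open>B2\<close> and of \<open>B3\<close>,
  \<open>B4\<close> are the same four points, and likewise for \<open>B1\<close>, \<open>B3\<close>
  and \<open>B2\<close>, \<open>B4\<close>. This yields two intersections of hyperplanes that cover
  all but one point of \<open>X\<close>.\<close>

lemma type43_four:
  assumes Y: "y1 \<in> Y" "y2 \<in> Y" "y3 \<in> Y" "y4 \<in> Y" "distinct [y1,y2,y3,y4]"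
    and B: "type43 y1 B1" "type43 y2 B2" "type43 y3 B3" "type43 y4 B4"
  shows False
proof -
  have ne: "y1 \<noteq> y2" "y1 \<noteq> y3" "y1 \<noteq> y4" "y2 \<noteq> y3" "y2 \<noteq> y4" "y3 \<noteq> y4"
    using Y(5) by auto
  obtain p12 where p12: "B1 \<inter> B2 = {p12}"
    using type43_inter[OF Y(1,2) ne(1) B(1,2)] card_1_singletonE by metis
  obtain p13 where p13: "B1 \<inter> B3 = {p13}"
    using type43_inter[OF Y(1,3) ne(2) B(1,3)] card_1_singletonE by metis
  obtain p14 where p14: "B1 \<inter> B4 = {p14}"
    using type43_inter[OF Y(1,4) ne(3) B(1,4)] card_1_singletonE by metis
  obtain p23 where p23: "B2 \<inter> B3 = {p23}"
    using type43_inter[OF Y(2,3) ne(4) B(2,3)] card_1_singletonE by metis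
  obtain p24 where p24: "B2 \<inter> B4 = {p24}"
    using type43_inter[OF Y(2,4) ne(5) B(2,4)] card_1_singletonE by metis
  obtain p34 where p34: "B3 \<inter> B4 = {p34}"
    using type43_inter[OF Y(3,4) ne(6) B(3,4)] card_1_singletonE by metis
  note t = type43_triple[OF Y(1,2,3) ne(1,2,4) B(1,2,3)] type43_triple[OF Y(1,2,4) ne(1,3,5) B(1,2,4)]
    type43_triple[OF Y(1,3,4) ne(2,3,6) B(1,3,4)] type43_triple[OF Y(2,3,4) ne(4,5,6) B(2,3,4)]
  have mem: "p12 \<in> B1" "p12 \<in> B2" "p13 \<in> B1" "p13 \<in> B3" "p14 \<in> B1" "p14 \<in> B4"
    "p23 \<in> B2" "p23 \<in> B3" "p24 \<in> B2" "p24 \<in> B4" "p34 \<in> B3" "p34 \<in> B4"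
    using p12 p13 p14 p23 p24 p34 by blast+
  have nmem: "p12 \<notin> B3" "p12 \<notin> B4" "p13 \<notin> B2" "p13 \<notin> B4" "p14 \<notin> B2" "p14 \<notin> B3"
    "p23 \<notin> B1" "p23 \<notin> B4" "p24 \<notin> B1" "p24 \<notin> B3" "p34 \<notin> B1" "p34 \<notin> B2"
    using t mem by blast+
  have d: "distinct [p12,p13,p14,p23,p24,p34]"
    using mem nmem by auto
  have sub: "B1 \<subseteq> X" "B2 \<subseteq> X" "B3 \<subseteq> X" "B4 \<subseteq> X"
    and c: "card B1 = 3" "card B2 = 3" "card B3 = 3" "card B4 = 3"
    using B unfolding type43_def by auto
  have three: "B = {a,b,e}" if "card B = 3" "a \<in> B" "b \<in> B" "e \<in> B" "distinct [a,b,e]" for B :: "'a set" and a b e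
  proof -
    have "finite B" using that(1) card.infinite by (metis zero_neq_numeral)
    moreover have "card {a,b,e} = card B" using that(1,5) by simp
    ultimately have "{a,b,e} = B" using card_subset_eq[of B "{a,b,e}"] that by simp
    then show ?thesis by simp
  qed
  have eq: "B1 = {p12,p13,p14}" "B2 = {p12,p23,p24}" "B3 = {p13,p23,p34}" "B4 = {p14,p24,p34}"
    using three c mem d by simp_all
  define Z where "Z = {p12,p13,p14,p23,p24,p34}"
  have "Z \<subseteq> X" "card Z = 6" unfolding Z_def using sub mem d by auto
  then have "card (X - Z) = 1" using cardX finX by (simp add: card_Diff_subset finite_subset)
  then obtain p where p: "X - Z = {p}" using card_1_singletonE by metis
  have neB: "B1 \<noteq> B2" "B1 \<noteq> B3" "B3 \<noteq> B4" "B2 \<noteq> B4" using mem nmem by metis+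
  obtain H where H: "hyperplane H" "y1 \<notin> H" "Y - {y1,y2} \<subseteq> H" "X \<inter> H = (B1 - B2) \<union> (B2 - B1)"
    using type43_line[OF Y(1,2) ne(1) B(1,2) neB(1)] by metis
  obtain H' where H': "hyperplane H'" "Y - {y3,y4} \<subseteq> H'" "X \<inter> H' = (B3 - B4) \<union> (B4 - B3)"
    using type43_line[OF Y(3,4) ne(6) B(3,4) neB(3)] by metis
  obtain K where K: "hyperplane K" "y1 \<notin> K" "Y - {y1,y3} \<subseteq> K" "X \<inter> K = (B1 - B3) \<union> (B3 - B1)"
    using type43_line[OF Y(1,3) ne(2) B(1,3) neB(2)] by metis
  obtain K' where K': "hyperplane K'" "Y - {y2,y4} \<subseteq> K'" "X \<inter> K' = (B2 - B4) \<union> (B4 - B2)"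
    using type43_line[OF Y(2,4) ne(5) B(2,4) neB(4)] by metis
  have mH: "{p13,p14,p23,p24} \<subseteq> H \<inter> H'"
    using H(4) H'(3) mem nmem sub by blast
  have mK: "{p12,p14,p23,p34} \<subseteq> K \<inter> K'"
    using K(4) K'(3) mem nmem sub by blast
  have "card (Y - {y1,y2,y3,y4}) = 1"
    using Y cardY finY by (simp add: card_Diff_subset)
  then obtain y5 where y5: "Y - {y1,y2,y3,y4} = {y5}" using card_1_singletonE by metis
  then have y5': "y5 \<in> Y" "y5 \<noteq> y1" "y5 \<noteq> y2" "y5 \<noteq> y3" "y5 \<noteq> y4" by blast+
  \<comment> \<open>\<open>p14\<close> and \<open>p23\<close> are the points common to both 4-sets,
    and \<open>y5\<close> lies in all four hyperplanes.\<close>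
  define I where "I = {y5,p14,p23}"
  have pX: "p14 \<in> X" "p23 \<in> X" using sub mem by blast+
  then have "p14 \<noteq> y5" "p23 \<noteq> y5" using disj y5'(1) by blast+
  then have cI: "card I = 3" unfolding I_def using d by auto
  have "p23 \<notin> block y1 p14"
    using type43_block[OF B(1) pX] mem nmem by simp
  then have I: "indep I"
    unfolding I_def by (intro indep_subset[OF indep_pair[OF Y(1) pX]]) (use y5' in auto)
  have IH: "I \<subseteq> H \<inter> H'" unfolding I_def using mH H(3) H'(2) y5' by blast
  have IK: "I \<subseteq> K \<inter> K'" unfolding I_def using mK K(3) K'(2) y5' by blast
  have "H \<noteq> H'" "K \<noteq> K'" using H(2) H'(2) K(2) K'(2) Y(1) ne by blast+
  moreover have "X - {p} \<subseteq> (H \<inter> H') \<union> (K \<inter> K')"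
    using p mH mK unfolding Z_def by blast
  moreover have "p \<in> X" using p by blast
  ultimately show False
    using two_lines[OF H(1) H'(1) _ K(1) K'(1) _ I cI IH IK] by metis
qed

lemma card_type43_le: "card {y \<in> Y. \<forall>x. \<not> sing y x} \<le> 3"
proof (rule ccontr)
  assume "\<not> card {y \<in> Y. \<forall>x. \<not> sing y x} \<le> 3"
  then have "4 \<le> card {y \<in> Y. \<forall>x. \<not> sing y x}" by simp
  then obtain T where T: "T \<subseteq> {y \<in> Y. \<forall>x. \<not> sing y x}" "card T = 4"
    by (rule obtain_subset_with_card_n)
  have "card T = Suc 3" using T(2) by simp
  then obtain y1 T' where T': "T = insert y1 T'" "y1 \<notin> T'" "card T' = 3"
    unfolding card_Suc_eq by metis
  then obtain y2 y3 y4 where "T' = {y2,y3,y4}" "y2 \<noteq> y3" "y2 \<noteq> y4" "y3 \<noteq> y4"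
    by (auto simp: card_3_iff)
  then have y: "T = {y1,y2,y3,y4}" "distinct [y1,y2,y3,y4]"
    using T' by auto
  then have m: "y1 \<in> Y" "y2 \<in> Y" "y3 \<in> Y" "y4 \<in> Y"
    and n: "\<And>x. \<not> sing y1 x" "\<And>x. \<not> sing y2 x" "\<And>x. \<not> sing y3 x" "\<And>x. \<not> sing y4 x"
    using T(1) by auto
  show False
    using obtain_type43[OF m(1) n(1)] obtain_type43[OF m(2) n(2)] obtain_type43[OF m(3) n(3)]
      obtain_type43[OF m(4) n(4)] type43_four[OF m y(2)] by metis
qed

text \<open>If \<open>x\<close> were outside \<open>B\<close>, one of \<open>U\<close> and
  \<open>V\<close>, say \<open>V\<close>, would meet \<open>B\<close> at most once. If they are
  disjoint, \<open>B = U\<close> and a transversal contains six elements of \<open>X\<close>;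
  otherwise one has a trace of size 2. \<open>card_trace\<close> excludes both.\<close>

lemma type43_type331:
  assumes yz: "y \<in> Y" "z \<in> Y" "y \<noteq> z" and B: "type43 y B" and UV: "type331 z x U V"
  shows "x \<in> B"
proof (rule ccontr)
  assume x: "x \<notin> B"
  have main: False if UV: "type331 z x U V" and le: "card (B \<inter> V) \<le> 1" for U V
  proof -
    have sub: "B \<subseteq> X" and cB: "card B = 3" using B unfolding type43_def by auto
    have X: "X = insert x (U \<union> V)" "x \<notin> U" "x \<notin> V" "U \<inter> V = {}" and c: "card U = 3" "card V = 3"
      and blz: "block z x = {x}" "\<And>a. a \<in> U \<Longrightarrow> block z a = U" "\<And>a. a \<in> V \<Longrightarrow> block z a = V"
      using UV unfolding type331_def sing_def by auto
    have fin: "finite B" "finite U" "finite V"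
      using finX sub X(1) finite_subset by auto
    note bly = type43_block[OF B]
    have BUV: "B = (B \<inter> U) \<union> (B \<inter> V)" using sub X(1) x by blast
    have "card B = card (B \<inter> U) + card (B \<inter> V)"
      using fin X(4) by (subst BUV, intro card_Un_disjoint) auto
    then have UB: "card (U - B) = card (B \<inter> V)"
      using fin c cB by (simp add: card_Diff_subset_Int Int_commute)
    have VB: "card (V - B) = 3 - card (B \<inter> V)"
      using fin c by (simp add: card_Diff_subset_Int Int_commute)
    show False
    proof (cases "card (B \<inter> V) = 0")
      case True
      then have "B \<inter> V = {}" "U - B = {}" using UB fin by simp_all
      then have BU: "B = U" using BUV by blast
      have "U \<noteq> {}" "V \<noteq> {}" using c by auto
      then obtain u v where uv: "u \<in> U" "v \<in> V" by blast
      then have uvX: "u \<in> X" "v \<in> X" "v \<notin> U" using X(1,4) by blast+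
      have "v \<notin> block y u" "v \<notin> block z u"
        using bly uv uvX blz BU by simp_all
      from transversal[OF yz uvX(1,2) this] obtain H where H: "hyperplane H" "u \<in> H" "v \<in> H"
        "\<And>c d. c \<in> X \<Longrightarrow> d \<in> X \<Longrightarrow> c \<in> H \<Longrightarrow> d \<in> block y c \<Longrightarrow> d \<in> block z c \<Longrightarrow> d \<in> H"
        by metis
      have "U \<union> V \<subseteq> X \<inter> H"
      proof
        fix d assume d: "d \<in> U \<union> V"
        then have "d \<in> X" using X(1) by blast
        then show "d \<in> X \<inter> H"
          using d H(4)[OF uvX(1), of d] H(4)[OF uvX(2), of d] H(2,3) bly uv uvX blz BU X(4) by auto
      qed
      then have "card (U \<union> V) \<le> card (X \<inter> H)" using finX by (intro card_mono) auto
      moreover have "card (U \<union> V) = 6" using c fin X(4) by (simp add: card_Un_disjoint)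
      ultimately show False using card_trace(2)[OF H(1)] by simp
    next
      case False
      then have one: "card (B \<inter> V) = 1" "card (U - B) = 1" using le UB by simp_all
      then obtain s p where s: "B \<inter> V = {s}" and p: "U - B = {p}" using card_1_singletonE by metis
      then have sp: "s \<in> X" "p \<in> X" "s \<in> B" "s \<in> V" "p \<in> U" "p \<notin> B" "p \<notin> V" using X by blast+
      have "p \<notin> block y s" "p \<notin> block z s"
        using bly blz sp by simp_all
      from transversal[OF yz sp(1,2) this] obtain H where H: "hyperplane H" "s \<in> H" "p \<in> H"
        "\<And>c d. c \<in> X \<Longrightarrow> d \<in> X \<Longrightarrow> c \<in> H \<Longrightarrow> d \<in> H \<Longrightarrow> d \<in> block y c \<longleftrightarrow> d \<in> block z c"
        by metis
      \<comment> \<open>On the line, sharing a block with \<open>s\<close> or \<open>p\<close> in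
        one partition means sharing it in both. Since \<open>B\<close> and its complement cover
        \<open>X\<close>, only the cells of \<open>s\<close> and \<open>p\<close> remain.\<close>
      have "X \<inter> H = {s,p}"
      proof (intro equalityI subsetI)
        fix d assume d: "d \<in> X \<inter> H"
        then have "d \<in> B \<longleftrightarrow> d \<in> V" "d \<notin> B \<longleftrightarrow> d \<in> U"
          using H(4)[OF sp(1), of d] H(4)[OF sp(2), of d] H(2,3) bly blz sp by auto
        then show "d \<in> {s,p}" using s p by blast
      qed (use sp H in auto)
      moreover have "s \<noteq> p" using sp by blast
      ultimately show False using card_trace(1)[OF H(1)] by simp
    qed
  qed
  have "B \<inter> U \<inter> (B \<inter> V) = {}" "(B \<inter> U) \<union> (B \<inter> V) \<subseteq> B"
    using UV unfolding type331_def by blast+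
  moreover have fB: "finite B" "card B = 3"
    using B finX finite_subset unfolding type43_def by auto
  ultimately have "card (B \<inter> U) + card (B \<inter> V) \<le> 3"
    using card_mono[of B "(B \<inter> U) \<union> (B \<inter> V)"] card_Un_disjoint[of "B \<inter> U" "B \<inter> V"] by simp
  then have "card (B \<inter> U) \<le> 1 \<or> card (B \<inter> V) \<le> 1" by linarith
  then show False using main UV type331_commute[OF UV] by blast
qed

text \<open>After exchanging \<open>U'\<close> and \<open>V'\<close> if necessary, \<open>U\<close>
  meets \<open>U'\<close> at most once. If they are disjoint, the partitions agree and a transversal
  contains six elements of \<open>X\<close>. Otherwise the line through the single points of
  \<open>U \<inter> U'\<close> and \<open>V \<inter> V'\<close> can contain only \<open>x\<close>
  besides, and must do so because a trace of size 2 is excluded.\<close>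

lemma type331_line:
  assumes yz: "y \<in> Y" "z \<in> Y" "y \<noteq> z" and UV: "type331 y x U V" and UV': "type331 z x U' V'"
  obtains H where "hyperplane H" "y \<notin> H" "z \<notin> H" "x \<in> H" "card (X \<inter> H) = 3"
proof -
  have main: "\<exists>H. hyperplane H \<and> y \<notin> H \<and> z \<notin> H \<and> x \<in> H \<and> card (X \<inter> H) = 3"
    if UV': "type331 z x U' V'" and le: "card (U \<inter> U') \<le> 1" for U' V'
  proof -
    have X: "X = insert x (U \<union> V)" "x \<notin> U" "x \<notin> V" "U \<inter> V = {}" and c: "card U = 3" "card V = 3"
      and bly: "\<And>a. a \<in> U \<Longrightarrow> block y a = U" "\<And>a. a \<in> V \<Longrightarrow> block y a = V"
      using UV unfolding type331_def by auto
    have X': "X = insert x (U' \<union> V')" "x \<notin> U'" "x \<notin> V'" "U' \<inter> V' = {}" and c': "card U' = 3" "card V' = 3"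
      and blz: "\<And>a. a \<in> U' \<Longrightarrow> block z a = U'" "\<And>a. a \<in> V' \<Longrightarrow> block z a = V'"
      using UV' unfolding type331_def by auto
    have fin: "finite U" "finite V" "finite U'" "finite V'"
      using finX[unfolded X(1)] finX[unfolded X'(1)] by simp_all
    have UV: "U \<union> V = X - {x}" using X by blast
    moreover have "U' \<union> V' = X - {x}" using X' by blast
    ultimately have un: "U \<union> V = U' \<union> V'" by simp
    have VU: "V \<inter> U' = U' - U" using un X(4) by blast
    have "card (V \<inter> U') = 3 - card (U \<inter> U')"
      unfolding VU using c' fin by (simp add: card_Diff_subset_Int Int_commute)
    moreover have "V \<inter> V' = V - U'" using un X'(4) by blast
    ultimately have VV: "card (V \<inter> V') = card (U \<inter> U')"
      using c fin card_mono[of U "U \<inter> U'"] by (simp add: card_Diff_subset_Int)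
    show ?thesis
    proof (cases "card (U \<inter> U') = 0")
      case True
      then have "U \<inter> U' = {}" "V \<inter> V' = {}" using VV fin by simp_all
      then have "U \<subseteq> V'" "V \<subseteq> U'" using un by blast+
      then have eq: "U = V'" "V = U'"
        using card_subset_eq[of V' U] card_subset_eq[of U' V] fin c c' by simp_all
      have "U \<noteq> {}" "V \<noteq> {}" using c by auto
      then obtain u v where uv: "u \<in> U" "v \<in> V" by blast
      then have uvX: "u \<in> X" "v \<in> X" "v \<notin> U" using X(1,4) by blast+
      have "v \<notin> block y u" "v \<notin> block z u"
        using bly uv uvX blz eq by simp_all
      from transversal[OF yz uvX(1,2) this] obtain H where H: "hyperplane H" "u \<in> H" "v \<in> H"
        "\<And>c d. c \<in> X \<Longrightarrow> d \<in> X \<Longrightarrow> c \<in> H \<Longrightarrow> d \<in> block y c \<Longrightarrow> d \<in> block z c \<Longrightarrow> d \<in> H"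
        by metis
      have "U \<union> V \<subseteq> X \<inter> H"
      proof
        fix d assume d: "d \<in> U \<union> V"
        then have "d \<in> X" using X(1) by blast
        then show "d \<in> X \<inter> H"
          using d H(4)[OF uvX(1), of d] H(4)[OF uvX(2), of d] H(2,3) bly uv blz eq by auto
      qed
      then have "card (U \<union> V) \<le> card (X \<inter> H)" using finX by (intro card_mono) auto
      moreover have "card (U \<union> V) = 6" using c fin X(4) by (simp add: card_Un_disjoint)
      ultimately show ?thesis using card_trace(2)[OF H(1)] by simp
    next
      case False
      then have one: "card (U \<inter> U') = 1" "card (V \<inter> V') = 1" using le VV by simp_all
      then obtain p s where p: "U \<inter> U' = {p}" and s: "V \<inter> V' = {s}" using card_1_singletonE by metis
      then have ps': "p \<in> U" "p \<in> U'" "s \<in> V" "s \<in> V'" by blast+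
      then have ps: "p \<in> X" "s \<in> X" "p \<in> U" "p \<in> U'" "s \<in> V" "s \<in> V'" "s \<notin> U" "s \<notin> U'"
        using UV X(4) X'(4) by blast+
      have "s \<notin> block y p" "s \<notin> block z p"
        using bly blz ps by simp_all
      from transversal[OF yz ps(1,2) this] obtain H where H: "hyperplane H" "y \<notin> H" "z \<notin> H" "p \<in> H" "s \<in> H"
        "\<And>c d. c \<in> X \<Longrightarrow> d \<in> X \<Longrightarrow> c \<in> H \<Longrightarrow> d \<in> H \<Longrightarrow> d \<in> block y c \<longleftrightarrow> d \<in> block z c"
        by metis
      have sub: "X \<inter> H \<subseteq> {x,p,s}"
      proof
        fix d assume d: "d \<in> X \<inter> H"
        then have "d \<in> U \<longleftrightarrow> d \<in> U'" "d \<in> V \<longleftrightarrow> d \<in> V'"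
          using H(6)[OF ps(1), of d] H(6)[OF ps(2), of d] H(4,5) bly blz ps by auto
        then show "d \<in> {x,p,s}" using d p s UV by blast
      qed
      have dist: "p \<noteq> s" "x \<noteq> p" "x \<noteq> s" "x \<in> X" using ps X(1-3) by auto
      have "x \<in> H"
      proof (rule ccontr)
        assume "x \<notin> H"
        then have "X \<inter> H = {p,s}" using sub ps H(4,5) by blast
        then show False using card_trace(1)[OF H(1)] dist by simp
      qed
      moreover from this have "X \<inter> H = {x,p,s}" using sub ps H(4,5) dist by blast
      then have "card (X \<inter> H) = 3" using dist by simp
      ultimately show ?thesis using H(1-3) by blast
    qed
  qed
  have "U' \<inter> V' = {}" using UV' unfolding type331_def by simp
  then have "U \<inter> U' \<inter> (U \<inter> V') = {}" "(U \<inter> U') \<union> (U \<inter> V') \<subseteq> U" by blast+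
  moreover have "card U = 3" using UV unfolding type331_def by simp
  moreover from this have "finite U" by (metis card.infinite zero_neq_numeral)
  ultimately have "card (U \<inter> U') + card (U \<inter> V') \<le> 3"
    using card_mono[of U "(U \<inter> U') \<union> (U \<inter> V')"] card_Un_disjoint[of "U \<inter> U'" "U \<inter> V'"] by simp
  then have "card (U \<inter> U') \<le> 1 \<or> card (U \<inter> V') \<le> 1" by linarith
  then show ?thesis using main UV' type331_commute[OF UV'] that by metis
qed

subsection \<open>Singletons of the partitions and of the dual partitions\<close>

text \<open>The set {x} is a block of y in the dual matroid.\<close>
definition cosing :: "'a \<Rightarrow> 'a \<Rightarrow> bool" where
  "cosing y x \<longleftrightarrow> x \<in> X \<and> circuit E indep (insert y X - {x})"

text \<open>\<open>y\<close> and \<open>z\<close> are distinct and outside \<open>X\<close>, so the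
  circuit and the cocircuit meet in \<open>X - {a,b}\<close>.\<close>

lemma sing_cosing:
  assumes yz: "y \<in> Y" "z \<in> Y" "y \<noteq> z" and b: "sing y b" and a: "cosing z a"
  shows "a = b"
proof (rule ccontr)
  assume ab: "a \<noteq> b"
  have "cci E indep ((insert z X - {a}) \<inter> (insert y X - {b}))"
    using a sing_cocircuit[OF yz(1) b] unfolding cosing_def cci_def by metis
  moreover have "(insert z X - {a}) \<inter> (insert y X - {b}) = X - {a,b}"
    using yz disj by blast
  moreover have "a \<in> X" "b \<in> X" using a b unfolding cosing_def sing_def by simp_all
  then have "card (X - {a,b}) = 5"
    using ab cardX finX by (simp add: card_Diff_subset)
  ultimately show False using no_cci by metis
qed

text \<open>A singleton of any other element of \<open>Y\<close> would equal both \<open>a\<close>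
  and \<open>a'\<close>. If these differ, four elements have no singleton, against
  \<open>card_type43_le\<close>.\<close>

lemma cosing_unique:
  assumes y: "y \<in> Y" and a: "cosing y a" "cosing y a'"
  shows "a = a'"
proof (rule ccontr)
  assume "a \<noteq> a'"
  then have "Y - {y} \<subseteq> {y \<in> Y. \<forall>x. \<not> sing y x}"
    using sing_cosing[OF _ y _ _ a(1)] sing_cosing[OF _ y _ _ a(2)] by blast
  then have "card (Y - {y}) \<le> card {y \<in> Y. \<forall>x. \<not> sing y x}"
    using finY by (intro card_mono) auto
  then show False
    using card_type43_le cardY y by simp
qed

lemma two_sings:
  obtains y y' b b' where "y \<in> Y" "y' \<in> Y" "y \<noteq> y'" "sing y b" "sing y' b'"
proof -
  let ?T = "{y \<in> Y. \<forall>x. \<not> sing y x}"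
  have "card (Y - ?T) = card Y - card ?T"
    using finY by (intro card_Diff_subset) auto
  then have "2 \<le> card (Y - ?T)" using card_type43_le cardY by linarith
  then obtain S where S: "S \<subseteq> Y - ?T" "card S = 2" by (rule obtain_subset_with_card_n)
  then obtain y y' where "S = {y,y'}" "y \<noteq> y'" by (auto simp: card_2_iff)
  then have "y \<in> Y" "y' \<in> Y" "\<exists>b. sing y b" "\<exists>b. sing y' b"
    using S(1) by auto
  then show ?thesis using that \<open>y \<noteq> y'\<close> by metis
qed

text \<open>Off \<open>H\<close> remain \<open>y\<close> and four elements of \<open>X\<close>. If
  \<open>cosing y x\<close> holds, this contradicts \<open>card_circuit_hyperplane\<close>.\<close>

lemma card_cosing_minus:
  assumes "y \<in> Y" "y \<notin> H" "x \<in> H" "x \<in> X" "card (X \<inter> H) = 3"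
  shows "card (insert y X - {x} - H) = 5"
proof -
  have "insert y X - {x} - H = insert y (X - H)" using assms by blast
  moreover have "y \<notin> X" using assms disj by blast
  ultimately show ?thesis
    using assms(5) cardX finX by (simp add: card_Diff_subset_Int)
qed

text \<open>The assumption is \<open>cosing_unique\<close> seen from the dual matroid, which the
  final proof supplies.\<close>

context
  assumes sing_unique: "y \<in> Y \<Longrightarrow> sing y a \<Longrightarrow> sing y b \<Longrightarrow> a = b"
begin

text \<open>The hyperplane from \<open>type331_line\<close> leaves five elements of the circuit
  \<open>insert y X - {x}\<close> uncovered.\<close>

lemma sing_sing_cosing:
  assumes yz: "y \<in> Y" "z \<in> Y" "y \<noteq> z" and s: "sing y x" "sing z x" "cosing y x"
  shows False
proof -
  obtain U V where 1: "type331 y x U V"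
    using obtain_type331[OF yz(1) s(1)] sing_unique[OF yz(1) _ s(1)] by metis
  obtain U' V' where 2: "type331 z x U' V'"
    using obtain_type331[OF yz(2) s(2)] sing_unique[OF yz(2) _ s(2)] by metis
  obtain H where H: "hyperplane H" "y \<notin> H" "x \<in> H" "card (X \<inter> H) = 3"
    using type331_line[OF yz 1 2] by metis
  show False
    using card_cosing_minus[OF yz(1) H(2,3) _ H(4)] card_circuit_hyperplane[OF _ H(1)] s(3)
    unfolding cosing_def by metis
qed

lemma mem_type43:
  assumes yz: "y \<in> Y" "z \<in> Y" "y \<noteq> z" and B: "type43 y B" and s: "sing z x"
  shows "x \<in> B"
proof -
  obtain U V where "type331 z x U V"
    using obtain_type331[OF yz(2) s] sing_unique[OF yz(2) _ s] by metis
  from type43_type331[OF yz B this] show ?thesis .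
qed

text \<open>The singleton of \<open>z\<close> forces \<open>x\<close> into the 3-element block of
  \<open>y\<close>, so \<open>hyp y x\<close> is a hyperplane to which
  \<open>card_cosing_minus\<close> applies.\<close>

lemma no_sing_cosing:
  assumes yz: "y \<in> Y" "z \<in> Y" "y \<noteq> z" and s: "\<And>x. \<not> sing y x" "sing z x" "cosing y x"
  shows False
proof -
  obtain B where B: "type43 y B" using obtain_type43[OF yz(1) s(1)] by metis
  have x: "x \<in> B" by (rule mem_type43[OF yz B s(2)])
  have xX: "x \<in> X" using s(3) unfolding cosing_def by simp
  note p = hyp_props[OF yz(1) xX]
  have "X \<inter> hyp y x = B" "card B = 3"
    using B x unfolding type43_def block_def by simp_all
  then have "card (insert y X - {x} - hyp y x) = 5"
    using card_cosing_minus[OF yz(1) p(4,2) xX] by simp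
  then show False
    using card_circuit_hyperplane[OF _ p(1)] s(3) unfolding cosing_def by metis
qed

text \<open>Both singletons lie in the 3-element blocks of \<open>y\<close> and of
  \<open>y'\<close>, which meet in one point.\<close>

lemma no_sing_pair:
  assumes y: "y \<in> Y" "y' \<in> Y" "y \<noteq> y'" and n: "\<And>x. \<not> sing y x" "\<And>x. \<not> sing y' x"
    and z: "z \<in> Y" "sing z b" "z' \<in> Y" "sing z' b'"
  shows "b = b'"
proof -
  obtain B where B: "type43 y B" using obtain_type43[OF y(1) n(1)] by metis
  obtain B' where B': "type43 y' B'" using obtain_type43[OF y(2) n(2)] by metis
  have ne: "y \<noteq> z" "y \<noteq> z'" "y' \<noteq> z" "y' \<noteq> z'" using n z by metis+
  have "b \<in> B" "b \<in> B'" "b' \<in> B" "b' \<in> B'"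
    using mem_type43[OF y(1) z(1) ne(1) B z(2)] mem_type43[OF y(2) z(1) ne(3) B' z(2)]
      mem_type43[OF y(1) z(3) ne(2) B z(4)] mem_type43[OF y(2) z(3) ne(4) B' z(4)] by simp_all
  moreover obtain c where "B \<inter> B' = {c}"
    using type43_inter[OF y B B'] card_1_singletonE by metis
  ultimately show ?thesis by (metis IntI singletonD)
qed

text \<open>If \<open>z\<close> were neither, \<open>sing_cosing\<close> would give
  \<open>a = b = b'\<close>, and also \<open>a' = a\<close> since \<open>z'\<close> differs from
  \<open>y\<close> or \<open>y'\<close>. A singleton of \<open>z\<close> would equal
  \<open>a'\<close>, hence \<open>b\<close>, which \<open>sing_sing_cosing\<close> excludes;
  \<open>no_sing_cosing\<close> excludes that there is none.\<close>

lemma cosing_imp_sing: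
  assumes y: "y \<in> Y" "y' \<in> Y" "y \<noteq> y'" "sing y b" "sing y' b'"
    and z: "z \<in> Y" "z' \<in> Y" "z \<noteq> z'" "cosing z a" "cosing z' a'"
  shows "z = y \<or> z = y'"
proof (rule ccontr)
  assume n: "\<not> (z = y \<or> z = y')"
  then have a: "a = b" "a = b'"
    using sing_cosing[OF y(1) z(1) _ y(4) z(4)] sing_cosing[OF y(2) z(1) _ y(5) z(4)] by auto
  show False
  proof (cases "\<exists>c. sing z c")
    case True
    then obtain c where c: "sing z c" ..
    then have "a' = c"
      using sing_cosing[OF z(1,2,3) c z(5)] by simp
    moreover have "a' = a"
      using sing_cosing[OF y(1) z(2) _ y(4) z(5)] sing_cosing[OF y(2) z(2) _ y(5) z(5)] a y(3) by metis
    ultimately have "sing z b" "cosing z b" using c z(4) a by simp_all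
    then show False
      using sing_sing_cosing[OF z(1) y(1) _ _ y(4)] n by blast
  next
    case False
    then show False
      using no_sing_cosing[OF z(1) y(1) _ _ y(4)] n z(4) a by blast
  qed
qed

text \<open>Both \<open>z\<close> and \<open>z'\<close> have singletons \<open>c\<close> and
  \<open>c'\<close>, and \<open>sing_cosing\<close> crosses them: \<open>a = c'\<close> and
  \<open>a' = c\<close>. They differ by \<open>sing_sing_cosing\<close>, so the other three elements
  have no singleton, and two of these force \<open>c = c'\<close> by
  \<open>no_sing_pair\<close>.\<close>

lemma at_most_one_cosing:
  assumes z: "z \<in> Y" "z' \<in> Y" "z \<noteq> z'" "cosing z a" "cosing z' a'"
  shows False
proof -
  obtain y y' b b' where y: "y \<in> Y" "y' \<in> Y" "y \<noteq> y'" "sing y b" "sing y' b'"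
    by (rule two_sings)
  have "z = y \<or> z = y'" "z' = y \<or> z' = y'"
    using cosing_imp_sing[OF y z] cosing_imp_sing[OF y z(2,1) z(3)[symmetric] z(5,4)] by simp_all
  then obtain c c' where s: "sing z c" "sing z' c'" using y(4,5) by metis
  have cc: "a = c'" "a' = c"
    using sing_cosing[OF z(2,1) z(3)[symmetric] s(2) z(4)] sing_cosing[OF z(1,2,3) s(1) z(5)] by simp_all
  have ne: "c \<noteq> c'"
    using sing_sing_cosing[OF z(1-3) s(1)] s(2) z(4) cc by metis
  have n: "\<not> sing w e" if w: "w \<in> Y - {z,z'}" for w e
  proof
    assume e: "sing w e"
    have "a = e" "a' = e"
      using sing_cosing[OF _ z(1) _ e z(4)] sing_cosing[OF _ z(2) _ e z(5)] w by auto
    then show False using cc ne by simp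
  qed
  have "card (Y - {z,z'}) = 3" using z cardY finY by (simp add: card_Diff_subset)
  then have "2 \<le> card (Y - {z,z'})" by simp
  then obtain S where S: "S \<subseteq> Y - {z,z'}" "card S = 2" by (rule obtain_subset_with_card_n)
  then obtain w w' where "S = {w,w'}" "w \<noteq> w'" by (auto simp: card_2_iff)
  then have w: "w \<in> Y - {z,z'}" "w' \<in> Y - {z,z'}" "w \<noteq> w'" using S(1) by auto
  have "c = c'"
    using no_sing_pair[OF _ _ w(3) n[OF w(1)] n[OF w(2)] z(1) s(1) z(2) s(2)] w by blast
  then show False using ne by simp
qed

end

section \<open>Duality of envelopes and the final contradiction\<close>

lemma envelope_dual: "envelope E (dual_indep E indep) X Y"
proof -
  interpret dual: matroid E "dual_indep E indep" by (rule matroid_dual)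
  show ?thesis
  proof
    fix x assume x: "x \<in> X"
    have "E - (X - {x}) = insert x Y" "E - insert x Y = X - {x}" "insert x Y \<subseteq> E" "X - {x} \<subseteq> E"
      using x ground disj by blast+
    then show "basis (dual_indep E indep) (X - {x})" "basis (dual_indep E indep) (insert x Y)"
      using basis_dual_iff basisX[OF x] basisY[OF x] by simp_all
  qed (use ground disj cardX cardY no_cci cci_dual in auto)
qed

end

text \<open>In rank \<open>r\<close> the sizes of \<open>C\<close> and \<open>D\<close> are at most
  \<open>r + 1\<close> and \<open>13 - r\<close>, but at least 7. Hence \<open>r = 6\<close>, both
  sizes are 7, and both sets equal their intersection.\<close>

lemma (in matroid) envelope_of_cci:
  assumes E: "card E = 12" and C: "circuit E indep C" and D: "cocircuit E indep D" and CD: "card (C \<inter> D) = 7"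
    and no: "\<And>Z. cci E indep Z \<Longrightarrow> card Z \<noteq> 5"
  shows "envelope E indep C (E - C)"
proof -
  interpret dual: matroid E "dual_indep E indep" by (rule matroid_dual)
  obtain B where B: "basis indep B" using basis_exists by blast
  then have BE: "B \<subseteq> E" using indep_ground unfolding basis_def by metis
  then have "E - (E - B) = B" by blast
  then have B': "basis (dual_indep E indep) (E - B)"
    using B basis_dual_iff[of "E - B"] by simp
  have cB': "card (E - B) = 12 - card B"
    using BE E finite_ground finite_subset by (metis card_Diff_subset)
  have D': "circuit E (dual_indep E indep) D" using D unfolding cocircuit_def .
  have CE: "C \<subseteq> E" and DE: "D \<subseteq> E" using C D' unfolding circuit_def by simp_all
  then have fin: "finite C" "finite D" using finite_ground finite_subset by metis+
  have "card B \<le> 12"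
    using card_mono[OF finite_ground BE] E by simp
  have le: "7 \<le> card C" "7 \<le> card D"
    using card_mono[of C "C \<inter> D"] card_mono[of D "C \<inter> D"] fin CD by simp_all
  have "card C \<le> Suc (card B)" "card D \<le> Suc (12 - card B)"
    using card_circuit_le[OF C B] dual.card_circuit_le[OF D' B'] cB' by simp_all
  then have cB: "card B = 6" and c: "card C = 7" "card D = 7"
    using le \<open>card B \<le> 12\<close> by linarith+
  have "C \<inter> D = C"
    using card_subset_eq[of C "C \<inter> D"] fin c CD by simp
  moreover have "C \<inter> D = D"
    using card_subset_eq[of D "C \<inter> D"] fin c CD by simp
  ultimately have "D = C" by simp
  show ?thesis
  proof
    fix x assume x: "x \<in> C"
    have c6: "card (C - {x}) = 6" using c(1) x by simp
    have ps: "C - {x} \<subset> C" using x by blast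
    have "indep (C - {x})" using C ps unfolding circuit_def by metis
    then show "basis indep (C - {x})"
      using basis_if_card[OF _ B] c6 cB by simp
    have "dual_indep E indep (C - {x})" using D' ps \<open>D = C\<close> unfolding circuit_def by metis
    then have "basis (dual_indep E indep) (C - {x})"
      using dual.basis_if_card[OF _ B'] c6 cB cB' by simp
    then have "basis indep (E - (C - {x}))" using basis_dual_iff by simp
    moreover have "E - (C - {x}) = insert x (E - C)" using x CE by blast
    ultimately show "basis indep (insert x (E - C))" by simp
  next
    show "card (E - C) = 5"
      using CE E c(1) fin(1) by (simp add: card_Diff_subset)
  qed (use CE c(1) no in auto)
qed

theorem theorem2p7:
  fixes E :: "'a set" and indep :: "'a set \<Rightarrow> bool"
  assumes "matroid E indep"
    and "card E = 12"
    and "\<exists>X. cci E indep X \<and> card X = 7"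
  shows "\<exists>X. cci E indep X \<and> card X = 5"
proof (rule ccontr)
  assume no: "\<not> (\<exists>X. cci E indep X \<and> card X = 5)"
  interpret matroid E indep by fact
  obtain X D where "circuit E indep X" "cocircuit E indep D" "card (X \<inter> D) = 7"
    using assms(3) unfolding cci_def by metis
  then have "envelope E indep X (E - X)"
    using envelope_of_cci[OF assms(2)] no by metis
  then interpret M: envelope E indep X "E - X" .
  interpret N: envelope E "dual_indep E indep" X "E - X" by (rule M.envelope_dual)
  \<comment> \<open>Dualising turns the cocircuit of a singleton into a circuit, so singletons on
    either side are cosingletons on the other.\<close>
  have co: "N.cosing y x" if "y \<in> E - X" "M.sing y x" for y x
    using M.sing_cocircuit[OF that] that(2) unfolding N.cosing_def M.sing_def cocircuit_def by simp
  have co': "M.cosing y x" if "y \<in> E - X" "N.sing y x" for y x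
    using N.sing_cocircuit[OF that] that(2) unfolding M.cosing_def N.sing_def cocircuit_dual by simp
  have uniq: "a = b" if "y \<in> E - X" "M.sing y a" "M.sing y b" for y a b
    using N.cosing_unique[OF that(1)] co that by metis
  \<comment> \<open>Two singletons of the dual are two cosingletons of the original matroid, one
    more than it allows.\<close>
  obtain z z' a a' where z: "z \<in> E - X" "z' \<in> E - X" "z \<noteq> z'" "N.sing z a" "N.sing z' a'"
    by (rule N.two_sings)
  show False
    by (rule M.at_most_one_cosing[OF _ z(1-3) co'[OF z(1,4)] co'[OF z(2,5)]]) (rule uniq)
qed

end
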